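(* Let $F$ be a free entire function with coefficients in $B(\mathcal{K})$ and let $$F(X_1,\ldots,X_n)=\sum_{k=0}^\infty\sum_{|\alpha|=k}A_{(\alpha)}\otimes X_\alpha$$ be its representation on an infinite dimensional Hilbert space $\mathcal{H}$. Let $m\in\{0,1,2,\ldots\}$. Then $F$ is a polynomial of degree $\le m$ if and only if there are constants $M>0$ and $C>1$ such that $$\|F(X_1,\ldots,X_n)\|\le M\|[X_1,\ldots,X_n]\|^m$$ for any $[X_1,\ldots,X_n]\in B(\mathcal{H})^n$ such that $\|[X_1,\ldots,X_n]\|\ge C$.
   Context: $\mathbb{F}_n^+$ is the unital free semigroup on generators $g_1,\ldots,g_n$ with identity $g_0$; $|\alpha|$ is word length; $X_\alpha:=X_{i_1}\cdots X_{i_k}$ if $\alpha=g_{i_1}\cdots g_{i_k}$ and $X_{g_0}:=I$. $\mathcal{K}$ is a Hilbert space. $\|[X_1,\ldots,X_n]\|:=\|X_1X_1^*+\cdots+X_nX_n^*\|^{1/2}$. A free entire function is a formal power series $\sum_{\alpha\in\mathbb{F}_n^+}A_{(\alpha)}\otimes Z_\alpha$, $A_{(\alpha)}\in B(\mathcal{K})$, in noncommuting indeterminates with radius of convergence $\infty$, i.e. $\limsup_{k\to\infty}\|\sum_{|\alpha|=k}A_{(\alpha)}^*A_{(\alpha)}\|^{1/2k}=0$; then the series for $F(X_1,\ldots,X_n)$ converges in the norm of $B(\mathcal{K}\otimes\mathcal{H})$ for all $[X_1,\ldots,X_n]\in B(\mathcal{H})^n$. $F$ is a polynomial of degree $\le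 m$ if $A_{(\alpha)}=0$ for all $|\alpha|>m$. *)

theory Defs
  imports "HOL-Analysis.Analysis"
begin

text \<open>
  Complex Hilbert spaces. The inner product is linear in its first argument. The underlying
  real Hilbert space carries the real part of the complex inner product, so the norm inherited from
  \<^class>\<open>real_inner\<close> is the usual Hilbert space norm, and the norm of the library type of bounded
  operators is the usual operator norm.
\<close>

class complex_hilbert_space = real_inner + complete_space +
  fixes scaleC :: "complex \<Rightarrow> 'a \<Rightarrow> 'a"  (infixr \<open>*\<^sub>C\<close> 75)
    and cinner :: "'a \<Rightarrow> 'a \<Rightarrow> complex"
  assumes scaleC_add_right: "c *\<^sub>C (x + y) = c *\<^sub>C x + c *\<^sub>C y"
    and scaleC_add_left: "(c + d) *\<^sub>C x = c *\<^sub>C x + d *\<^sub>C x"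
    and scaleC_scaleC: "c *\<^sub>C d *\<^sub>C x = (c * d) *\<^sub>C x"
    and scaleC_one: "1 *\<^sub>C x = x"
    and scaleR_scaleC: "r *\<^sub>R x = complex_of_real r *\<^sub>C x"
    and cinner_commute: "cinner x y = cnj (cinner y x)"
    and cinner_add_left: "cinner (x + y) z = cinner x z + cinner y z"
    and cinner_scaleC_left: "cinner (c *\<^sub>C x) y = c * cinner x y"
    and inner_eq_Re_cinner: "inner x y = Re (cinner x y)"

global_interpretation complex_vector: vector_space "scaleC :: complex \<Rightarrow> 'a \<Rightarrow> 'a::complex_hilbert_space"
  by unfold_locales (auto simp: scaleC_add_right scaleC_add_left scaleC_scaleC scaleC_one)

abbreviation cspan :: "'a::complex_hilbert_space set \<Rightarrow> 'a set"
  where "cspan \<equiv> module.span scaleC"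

abbreviation clinear :: "('a::complex_hilbert_space \<Rightarrow> 'b::complex_hilbert_space) \<Rightarrow> bool"
  where "clinear \<equiv> Vector_Spaces.linear scaleC scaleC"

definition infinite_dimensional :: "'a::complex_hilbert_space itself \<Rightarrow> bool"
  where "infinite_dimensional _ \<longleftrightarrow> \<not> (\<exists>B :: 'a set. finite B \<and> cspan B = UNIV)"

text \<open>
  The algebra \<open>B(H)\<close>. The library type of bounded operators only requires real linearity.
\<close>

definition bounded_ops :: "('a::complex_hilbert_space \<Rightarrow>\<^sub>L 'a) set"
  where "bounded_ops = {T. clinear (blinfun_apply T)}"

definition adj :: "('a::complex_hilbert_space \<Rightarrow>\<^sub>L 'a) \<Rightarrow> ('a \<Rightarrow>\<^sub>L 'a)"
  where "adj T = (THE S :: 'a \<Rightarrow>\<^sub>L 'a. \<forall>x y. cinner (T x) y = cinner x (S y))"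

text \<open>
  \<open>tens\<close> exhibits its codomain as the Hilbert space tensor product of \<open>'k\<close> and \<open>'h\<close>, which these
  conditions determine up to a unique unitary compatible with the elementary tensors.
\<close>

definition hilbert_tensor ::
  "('k::complex_hilbert_space \<Rightarrow> 'h::complex_hilbert_space \<Rightarrow> 'kh::complex_hilbert_space) \<Rightarrow> bool"
  where "hilbert_tensor tens \<longleftrightarrow>
    (\<forall>y. clinear (\<lambda>x. tens x y)) \<and> (\<forall>x. clinear (tens x)) \<and>
    (\<forall>x y x' y'. cinner (tens x y) (tens x' y') = cinner x x' * cinner y y') \<and>
    closure (cspan (range (\<lambda>(x, y). tens x y))) = UNIV"

definition tensor_op ::
  "('k::complex_hilbert_space \<Rightarrow> 'h::complex_hilbert_space \<Rightarrow> 'kh::complex_hilbert_space) \<Rightarrow>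
   ('k \<Rightarrow>\<^sub>L 'k) \<Rightarrow> ('h \<Rightarrow>\<^sub>L 'h) \<Rightarrow> ('kh \<Rightarrow>\<^sub>L 'kh)"
  where "tensor_op tens A X = (THE T :: 'kh \<Rightarrow>\<^sub>L 'kh. \<forall>x y. T (tens x y) = tens (A x) (X y))"

text \<open>
  The generators are indexed by a finite type \<open>'n\<close> with \<open>n = CARD('n)\<close>; the free semigroup on them is
  the type of words \<open>'n list\<close>, with the empty word as identity. A formal power series is given by its
  family of coefficients.
\<close>

definition word_op :: "('n \<Rightarrow> ('h::complex_hilbert_space \<Rightarrow>\<^sub>L 'h)) \<Rightarrow> 'n list \<Rightarrow> ('h \<Rightarrow>\<^sub>L 'h)"
  where "word_op X \<alpha> = foldr (\<lambda>i T. X i o\<^sub>L T) \<alpha> id_blinfun"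

definition row_norm :: "('n::finite \<Rightarrow> ('h::complex_hilbert_space \<Rightarrow>\<^sub>L 'h)) \<Rightarrow> real"
  where "row_norm X = sqrt (norm (\<Sum>i\<in>UNIV. X i o\<^sub>L adj (X i)))"

text \<open>The value of the sequence at \<open>k = 0\<close> is immaterial (\<^term>\<open>root 0\<close> is the zero function).\<close>

definition free_entire :: "('n::finite list \<Rightarrow> ('k::complex_hilbert_space \<Rightarrow>\<^sub>L 'k)) \<Rightarrow> bool"
  where "free_entire A \<longleftrightarrow>
    (\<forall>\<alpha>. A \<alpha> \<in> bounded_ops) \<and>
    limsup (\<lambda>k. ereal (root (2 * k) (norm (\<Sum>\<alpha> | length \<alpha> = k. adj (A \<alpha>) o\<^sub>L A \<alpha>)))) = 0"

definition polynomial_degree_le ::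
  "('n list \<Rightarrow> ('k::complex_hilbert_space \<Rightarrow>\<^sub>L 'k)) \<Rightarrow> nat \<Rightarrow> bool"
  where "polynomial_degree_le A m \<longleftrightarrow> (\<forall>\<alpha>. length \<alpha> > m \<longrightarrow> A \<alpha> = 0)"

definition free_eval ::
  "('k::complex_hilbert_space \<Rightarrow> 'h::complex_hilbert_space \<Rightarrow> 'kh::complex_hilbert_space) \<Rightarrow>
   ('n::finite list \<Rightarrow> ('k \<Rightarrow>\<^sub>L 'k)) \<Rightarrow> ('n \<Rightarrow> ('h \<Rightarrow>\<^sub>L 'h)) \<Rightarrow> ('kh \<Rightarrow>\<^sub>L 'kh)"
  where "free_eval tens A X =
    (\<Sum>k. \<Sum>\<alpha> | length \<alpha> = k. tensor_op tens (A \<alpha>) (word_op X \<alpha>))"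

text \<open>Sanity check: tensoring with the one-dimensional Hilbert space is scalar multiplication.\<close>

instantiation complex :: complex_hilbert_space
begin

definition scaleC_complex :: "complex \<Rightarrow> complex \<Rightarrow> complex"
  where "scaleC_complex c x = c * x"

definition cinner_complex :: "complex \<Rightarrow> complex \<Rightarrow> complex"
  where "cinner_complex x y = x * cnj y"

instance
  by standard
    (auto simp: scaleC_complex_def cinner_complex_def algebra_simps inner_complex_def scaleR_conv_of_real)

end

lemma hilbert_tensor_scaleC:
  "hilbert_tensor (scaleC :: complex \<Rightarrow> 'h \<Rightarrow> 'h::complex_hilbert_space)"
proof -
  have cinner_right: "cinner y (c *\<^sub>C z) = cnj c * cinner y z" for c and y z :: 'h
    by (metis cinner_commute cinner_scaleC_left complex_cnj_mult)
  have "range (\<lambda>(c, y :: 'h). c *\<^sub>C y) = UNIV"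
    by (auto intro!: image_eqI[where x = "(1, _)"] simp: scaleC_one)
  then show ?thesis
    unfolding hilbert_tensor_def
    by (auto intro!: Vector_Spaces.linear.intro module_hom.intro module_hom_axioms.intro
        complex_vector.vector_space_axioms complex_vector.module_axioms
        simp: scaleC_add_left scaleC_add_right scaleC_scaleC cinner_scaleC_left cinner_right
        cinner_complex_def scaleC_complex_def mult_ac)
qed

end

theory Submission
  imports Defs
begin

text \<open>
  The growth bound is tested on multiples of one nilpotent tuple for each word \<open>\<alpha>\<close> of length
  \<open>k > m\<close>. Take orthonormal vectors \<open>e\<^sub>0, \<dots>, e\<^sub>k\<close> and let \<open>X\<^sub>i\<close> map \<open>e\<^sub>j\<^sub>+\<^sub>1\<close> to \<open>e\<^sub>j\<close> when the
  letter of \<open>\<alpha>\<close> at position \<open>j\<close> (counted from 0) is \<open>i\<close>, and all other \<open>e\<close>'s to 0. Among all words,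
  only \<open>\<alpha>\<close> leads from \<open>e\<^sub>k\<close> to \<open>e\<^sub>0\<close>, and words longer than \<open>k\<close> act as 0, so \<open>F(rX)\<close> is a finite sum whose
  matrix coefficient at \<open>x \<otimes> e\<^sub>k\<close>, \<open>y \<otimes> e\<^sub>0\<close> is \<open>r\<^sup>k\<close> times that of the coefficient of \<open>\<alpha>\<close> at
  \<open>x\<close>, \<open>y\<close>. A bound of order \<open>r\<^sup>m\<close> forces the latter to vanish.
\<close>

section \<open>Complex inner products\<close>

lemma cinner_add_right: "cinner x (y + z) = cinner x y + cinner x z"
  for x :: "'a::complex_hilbert_space"
  by (metis cinner_add_left cinner_commute complex_cnj_add)

lemma cinner_scaleC_right: "cinner x (c *\<^sub>C y) = cnj c * cinner x y"
  for x :: "'a::complex_hilbert_space"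
  by (metis cinner_commute cinner_scaleC_left complex_cnj_mult)

lemma cinner_zero_left [simp]: "cinner 0 x = 0" for x :: "'a::complex_hilbert_space"
  using cinner_add_left[of 0 0 x] by simp

lemma cinner_zero_right [simp]: "cinner x 0 = 0" for x :: "'a::complex_hilbert_space"
  using cinner_add_right[of x 0 0] by simp

lemma cinner_diff_left: "cinner (x - y) z = cinner x z - cinner y z"
  for x :: "'a::complex_hilbert_space"
  using cinner_add_left[of "x - y" y z] by simp

lemma cinner_sum_left: "cinner (\<Sum>i\<in>I. f i) x = (\<Sum>i\<in>I. cinner (f i) x)"
  for x :: "'a::complex_hilbert_space"
  by (induction I rule: infinite_finite_induct) (auto simp: cinner_add_left)

lemma cinner_sum_right: "cinner x (\<Sum>i\<in>I. f i) = (\<Sum>i\<in>I. cinner x (f i))"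
  for x :: "'a::complex_hilbert_space"
  by (induction I rule: infinite_finite_induct) (auto simp: cinner_add_right)

lemma cinner_scaleR_left: "cinner (r *\<^sub>R x) y = of_real r * cinner x y"
  for x :: "'a::complex_hilbert_space"
  by (simp add: scaleR_scaleC cinner_scaleC_left)

lemma cinner_self: "cinner x x = of_real ((norm x)\<^sup>2)" for x :: "'a::complex_hilbert_space"
proof -
  have "Im (cinner x x) = 0"
    using arg_cong[OF cinner_commute[of x x], of Im] by simp
  then show ?thesis
    by (simp add: complex_eq_iff inner_eq_Re_cinner[symmetric] power2_norm_eq_inner)
qed

text \<open>Facts about the real \<open>inner\<close> transfer to \<open>cinner\<close> because the
  imaginary part is a real inner product too, with \<i> times the second argument.\<close>

lemma cinner_eq_inner: "cinner x y = Complex (inner x y) (inner x (\<i> *\<^sub>C y))"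
  for x :: "'a::complex_hilbert_space"
  by (simp add: complex_eq_iff inner_eq_Re_cinner cinner_scaleC_right)

lemma scaleC_eq_scaleR: "c *\<^sub>C x = Re c *\<^sub>R x + Im c *\<^sub>R \<i> *\<^sub>C x"
  for x :: "'a::complex_hilbert_space"
  by (simp add: scaleR_scaleC scaleC_scaleC flip: scaleC_add_left)
    (metis complex_eq mult.commute)

lemma clinearI:
  assumes "\<And>x y. f (x + y) = f x + f y" "\<And>c x. f (c *\<^sub>C x) = c *\<^sub>C f x"
  shows "clinear f"
  using assms by (auto intro!: Vector_Spaces.linear.intro module_hom.intro module_hom_axioms.intro
      complex_vector.vector_space_axioms complex_vector.module_axioms)

lemma clinear_add: "clinear f \<Longrightarrow> f (x + y) = f x + f y"
  by (simp add: Vector_Spaces.linear_def module_hom_def module_hom_axioms_def)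

lemma clinear_scaleC: "clinear f \<Longrightarrow> f (c *\<^sub>C x) = c *\<^sub>C f x"
  by (simp add: Vector_Spaces.linear_def module_hom_def module_hom_axioms_def)

lemma clinear_scaleR: "clinear f \<Longrightarrow> f (r *\<^sub>R x) = r *\<^sub>R f x"
  by (simp add: clinear_scaleC scaleR_scaleC)

lemma clinear_zero: "clinear f \<Longrightarrow> f 0 = 0"
  using clinear_scaleR[of f 0 0] by simp

lemma clinear_sum: "clinear f \<Longrightarrow> f (\<Sum>i\<in>I. g i) = (\<Sum>i\<in>I. f (g i))"
  by (induction I rule: infinite_finite_induct) (auto simp: clinear_add clinear_zero)

lemma bounded_ops_scaleR: "T \<in> bounded_ops \<Longrightarrow> r *\<^sub>R T \<in> bounded_ops"
  unfolding bounded_ops_def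
  by (auto intro!: clinearI simp: blinfun.scaleR_left blinfun.add_right scaleR_right_distrib
      clinear_scaleC scaleC_scaleC scaleR_scaleC mult.commute)

lemma zero_bounded_ops: "0 \<in> bounded_ops"
  by (auto simp: bounded_ops_def intro!: clinearI)

section \<open>Orthonormal sets\<close>

definition orthonormal :: "'a::complex_hilbert_space set \<Rightarrow> bool"
  where "orthonormal F \<longleftrightarrow> (\<forall>f\<in>F. \<forall>g\<in>F. cinner f g = (if f = g then 1 else 0))"

lemma cinner_orthonormal_sum:
  assumes "orthonormal F" "finite F" "g \<in> F"
  shows "cinner (\<Sum>f\<in>F. c f *\<^sub>C f) g = c g"
proof -
  have "cinner (\<Sum>f\<in>F. c f *\<^sub>C f) g = (\<Sum>f\<in>F. if f = g then c f else 0)"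
    using assms unfolding cinner_sum_left cinner_scaleC_left orthonormal_def
    by (intro sum.cong) auto
  then show ?thesis
    using assms by simp
qed

text \<open>One Gram-Schmidt step: unless it vanishes, the residue of \<open>y\<close> after
  projection onto the span of \<open>F\<close> is normalised and added. It serves both to build
  large orthonormal sets and to re-expand second tensor factors.\<close>

lemma orthonormal_extend:
  fixes F :: "'a::complex_hilbert_space set"
  assumes F: "orthonormal F" "finite F"
  obtains F' where "orthonormal F'" "finite F'" "F \<subseteq> F'" "y = (\<Sum>f\<in>F'. cinner y f *\<^sub>C f)"
proof -
  define p where "p = (\<Sum>f\<in>F. cinner y f *\<^sub>C f)"
  define g where "g = y - p"
  have gF: "cinner g f = 0" if "f \<in> F" for f
    using that F by (simp add: g_def p_def cinner_diff_left cinner_orthonormal_sum)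
  show thesis
  proof (cases "g = 0")
    case True
    then show thesis
      using that[of F] F by (simp add: g_def p_def)
  next
    case False
    define h where "h = (1 / norm g) *\<^sub>R g"
    have hF: "cinner h f = 0" if "f \<in> F" for f
      using gF[OF that] by (simp add: h_def cinner_scaleR_left)
    have hF': "cinner f h = 0" if "f \<in> F" for f
      using hF[OF that] by (metis cinner_commute complex_cnj_zero)
    have "norm h = 1"
      using False by (simp add: h_def)
    then have hh: "cinner h h = 1"
      by (simp add: cinner_self)
    have "h \<notin> F"
      using hF hh by force
    have yh: "y = p + norm g *\<^sub>R h"
      using False by (simp add: h_def g_def)
    have "cinner y h = norm g"
      unfolding yh cinner_add_left cinner_scaleR_left
      by (simp add: hh p_def cinner_sum_left cinner_scaleC_left hF')
    then have "(\<Sum>f\<in>insert h F. cinner y f *\<^sub>C f) = norm g *\<^sub>R h + p"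
      using \<open>h \<notin> F\<close> F by (simp add: p_def scaleR_scaleC)
    then have "y = (\<Sum>f\<in>insert h F. cinner y f *\<^sub>C f)"
      by (metis yh add.commute)
    moreover have "orthonormal (insert h F)"
      using F hF hF' hh by (auto simp: orthonormal_def)
    ultimately show thesis
      using that[of "insert h F"] F by auto
  qed
qed

text \<open>A finite set never spans, so a Gram-Schmidt step on a vector outside the span strictly
  enlarges the set.\<close>

lemma infinite_dimensional_orthonormal:
  assumes "infinite_dimensional TYPE('h::complex_hilbert_space)"
  shows "\<exists>F :: 'h set. orthonormal F \<and> finite F \<and> n \<le> card F"
proof (induction n)
  case 0
  show ?case
    by (rule exI[of _ "{}"]) (simp add: orthonormal_def)
next
  case (Suc n)
  then obtain F :: "'h set" where F: "orthonormal F" "finite F" "n \<le> card F"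
    by blast
  obtain y where y: "y \<notin> cspan F"
    using assms F unfolding infinite_dimensional_def by auto
  obtain F' where F': "orthonormal F'" "finite F'" "F \<subseteq> F'" "y = (\<Sum>f\<in>F'. cinner y f *\<^sub>C f)"
    using orthonormal_extend[OF F(1,2)] by blast
  have "y \<in> cspan F'"
    by (subst F'(4)) (intro complex_vector.span_sum complex_vector.span_scale
        complex_vector.span_base)
  then have "F \<subset> F'"
    using y F' by auto
  then have "card F < card F'"
    using F' psubset_card_mono by blast
  then show ?case
    using F F' by (intro exI[of _ F']) auto
qed

section \<open>Adjoints\<close>

text \<open>The representing vector minimises \<open>\<parallel>z\<parallel>\<^sup>2 - 2 \<phi> z\<close>.\<close>

lemma riesz_representation:
  fixes \<phi> :: "'a::complex_hilbert_space \<Rightarrow> real"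
  assumes "bounded_linear \<phi>"
  obtains z where "\<And>x. \<phi> x = inner x z"
proof -
  interpret \<phi>: bounded_linear \<phi> by fact
  define J where "J z = (norm z)\<^sup>2 - 2 * \<phi> z" for z
  obtain K where K: "\<And>x. norm (\<phi> x) \<le> norm x * K"
    using \<phi>.bounded by blast
  \<comment> \<open>Completing the square in |z|^2 - 2K|z| leaves at least -K^2.\<close>
  have lower: "- K\<^sup>2 \<le> J z" for z
  proof -
    have "0 \<le> (norm z - K)\<^sup>2" by simp
    moreover have "\<phi> z \<le> norm z * K" using K[of z] by auto
    ultimately show ?thesis unfolding J_def by (simp add: power2_diff)
  qed
  then have bdd: "bdd_below (range J)"
    by (auto simp: bdd_below_def)
  define \<mu> where "\<mu> = Inf (range J)"
  have \<mu>: "\<mu> \<le> J z" for z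
    unfolding \<mu>_def using bdd by (simp add: cINF_lower)
  have "\<exists>z. J z < \<mu> + 1 / Suc n" for n
    using cInf_lessD[of "range J" "\<mu> + 1 / Suc n"] by (auto simp: \<mu>_def)
  then obtain w where w: "\<And>n. J (w n) < \<mu> + 1 / Suc n"
    by metis
  \<comment> \<open>The parallelogram law; the terms in \<open>\<phi>\<close> cancel by linearity.
    Since \<open>J\<close> at the midpoint is at least \<open>\<mu>\<close>, near-minimisers are
    close to each other.\<close>
  have par: "(norm (a - b))\<^sup>2 = 2 * J a + 2 * J b - 4 * J ((1/2) *\<^sub>R (a + b))" for a b
    unfolding J_def power2_norm_eq_inner
    by (simp add: inner_add_left inner_add_right inner_diff_left
        inner_diff_right \<phi>.add \<phi>.scaleR inner_commute[of b a]) (simp add: field_simps)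
  have close: "(norm (w i - w j))\<^sup>2 \<le> 4 / Suc N" if "N \<le> i" "N \<le> j" for i j N
  proof -
    have "1 / Suc i \<le> 1 / Suc N" "1 / Suc j \<le> 1 / Suc N"
      using that by (auto intro!: divide_left_mono)
    then show ?thesis
      using par[of "w i" "w j"] w[of i] w[of j] \<mu>[of "(1/2) *\<^sub>R (w i + w j)"]
      by linarith
  qed
  have "Cauchy w"
  proof (rule metric_CauchyI)
    fix e :: real assume "0 < e"
    obtain N where "4 / e\<^sup>2 < real N"
      using reals_Archimedean2 by blast
    then have N: "4 / e\<^sup>2 < Suc N"
      by simp
    have "4 / Suc N < e\<^sup>2"
      using N \<open>0 < e\<close> by (simp add: field_simps)
    have "dist (w i) (w j) < e" if "N \<le> i" "N \<le> j" for i j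
    proof (rule power2_less_imp_less)
      show "(dist (w i) (w j))\<^sup>2 < e\<^sup>2"
        unfolding dist_norm using close[OF that] \<open>4 / Suc N < e\<^sup>2\<close> by linarith
    qed (use \<open>0 < e\<close> in simp)
    then show "\<exists>N. \<forall>i\<ge>N. \<forall>j\<ge>N. dist (w i) (w j) < e"
      by blast
  qed
  then obtain z where z: "w \<longlonglongrightarrow> z"
    using Cauchy_convergent convergent_def by blast
  have "(\<lambda>n. J (w n)) \<longlonglongrightarrow> J z"
    unfolding J_def by (intro tendsto_intros \<phi>.tendsto z)
  moreover have "(\<lambda>n. \<mu> + 1 / Suc n) \<longlonglongrightarrow> \<mu> + 0"
    by (intro tendsto_intros LIMSEQ_Suc[OF lim_const_over_n])
  ultimately have "J z \<le> \<mu> + 0"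
    using w by (intro LIMSEQ_le[of "\<lambda>n. J (w n)"]) (auto intro: less_imp_le)
  then have Jz: "J z \<le> J x" for x
    using \<mu>[of x] by simp
  have "\<phi> x = inner x z" for x
  proof -
    define d where "d = inner x z - \<phi> x"
    \<comment> \<open>The quadratic is \<open>J (z + t *\<^sub>R x) - J z\<close>. Its nonnegativity
      for all \<open>t\<close> will force the linear coefficient \<open>d\<close> to vanish.\<close>
    have quad: "0 \<le> 2 * t * d + t\<^sup>2 * (norm x)\<^sup>2" for t
    proof -
      have "(norm (z + t *\<^sub>R x))\<^sup>2 = (norm z)\<^sup>2 + 2 * t * inner x z + t\<^sup>2 * (norm x)\<^sup>2"
        unfolding power2_norm_eq_inner
        by (simp add: inner_add_left inner_add_right inner_commute[of z x] power2_eq_square distrib_left)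
      then show ?thesis
        using Jz[of "z + t *\<^sub>R x"] unfolding J_def d_def
        by (simp add: \<phi>.add \<phi>.scaleR algebra_simps)
    qed
    \<comment> \<open>With \<open>s\<close> in place of |x|^2 the choice \<open>t = - d / s\<close>
      needs no case \<open>x = 0\<close>, and the quadratic is still negative there unless
      \<open>d = 0\<close>.\<close>
    define s where "s = 1 + (norm x)\<^sup>2"
    have "0 < s" unfolding s_def by (simp add: add_pos_nonneg)
    define t where "t = - d / s"
    have ts: "t * s = - d" using \<open>0 < s\<close> by (simp add: t_def)
    have "0 \<le> (2 * t * d + t\<^sup>2 * (norm x)\<^sup>2) * s\<^sup>2"
      using quad[of t] by simp
    also have "\<dots> = 2 * (t * s) * d * s + (t * s)\<^sup>2 * (s - 1)"
      by (simp add: s_def power2_eq_square algebra_simps)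
    also have "\<dots> = - (d\<^sup>2 * (s + 1))"
      unfolding ts by (simp add: power2_eq_square algebra_simps)
    finally have "d\<^sup>2 * (s + 1) \<le> 0" by simp
    then have "d = 0"
      using \<open>0 < s\<close> by (simp add: mult_le_0_iff)
    then show ?thesis by (simp add: d_def)
  qed
  then show thesis using that by blast
qed

text \<open>Riesz representation for the real inner product gives a real adjoint; complex linearity
  of \<open>T\<close> makes it adjoint for \<open>cinner\<close> as well.\<close>

lemma adjoint_exists:
  fixes T :: "'a::complex_hilbert_space \<Rightarrow>\<^sub>L 'a"
  assumes "T \<in> bounded_ops"
  shows "\<exists>S :: 'a \<Rightarrow>\<^sub>L 'a. \<forall>x y. cinner (T x) y = cinner x (S y)"
proof -
  have "\<exists>z. \<forall>x. inner (T x) y = inner x z" for y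
    by (rule riesz_representation[of "\<lambda>x. inner (T x) y"])
      (auto intro!: bounded_linear_intros)
  then obtain S where S: "\<And>x y. inner (T x) y = inner x (S y)"
    by metis
  have uniq: "a = b" if "\<And>x. inner x a = inner x b" for a b :: 'a
    using that[of "a - b"] by (metis inner_diff_right inner_eq_zero_iff right_minus_eq)
  have "bounded_linear S"
  proof (rule bounded_linear_intro)
    show "S (x + y) = S x + S y" for x y
      by (rule uniq) (simp add: inner_add_right flip: S)
    show "S (r *\<^sub>R x) = r *\<^sub>R S x" for r x
      by (rule uniq) (simp flip: S)
    show "norm (S x) \<le> norm x * norm T" for x
    proof -
      have "norm (S x) * norm (S x) = inner (T (S x)) x"
        by (simp add: S norm_eq_sqrt_inner)
      also have "\<dots> \<le> norm (T (S x)) * norm x"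
        using Cauchy_Schwarz_ineq2 abs_le_D1 by blast
      also have "\<dots> \<le> norm T * norm (S x) * norm x"
        by (intro mult_right_mono norm_blinfun) simp
      finally have "norm (S x) * norm (S x) \<le> (norm x * norm T) * norm (S x)"
        by (simp add: mult_ac)
      then show ?thesis
        by (cases "S x = 0") auto
    qed
  qed
  moreover have "cinner (T x) y = cinner x (S y)" for x y
  proof -
    \<comment> \<open>The imaginary part of \<open>cinner\<close> is the real inner product with
      \<i> times the second argument, so moving \<i> to the first argument and through
      \<open>T\<close> settles it.\<close>
    have swap: "inner a (\<i> *\<^sub>C b) = - inner (\<i> *\<^sub>C a) b" for a b :: 'a
      by (simp add: inner_eq_Re_cinner cinner_scaleC_left cinner_scaleC_right)
    have "\<i> *\<^sub>C T x = T (\<i> *\<^sub>C x)"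
      using assms by (simp add: bounded_ops_def clinear_scaleC)
    then show ?thesis
      by (simp add: cinner_eq_inner swap S)
  qed
  ultimately show ?thesis
    by (intro exI[of _ "Blinfun S"]) (simp add: bounded_linear_Blinfun_apply)
qed

text \<open>Any candidate resolves the definite description in \<open>adj\<close>, since the
  difference of two candidate values is orthogonal to itself.\<close>

lemma adj_eqI:
  fixes T S :: "'a::complex_hilbert_space \<Rightarrow>\<^sub>L 'a"
  assumes "\<And>x y. cinner (T x) y = cinner x (S y)"
  shows "adj T = S"
  unfolding adj_def
proof (rule the_equality)
  fix S' :: "'a \<Rightarrow>\<^sub>L 'a" assume S': "\<forall>x y. cinner (T x) y = cinner x (S' y)"
  show "S' = S"
  proof (rule blinfun_eqI)
    fix y
    have "inner x (S' y) = inner x (S y)" for x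
      using S' assms by (metis inner_eq_Re_cinner)
    from this[of "S' y - S y"] show "S' y = S y"
      by (metis inner_diff_right inner_eq_zero_iff right_minus_eq)
  qed
qed (use assms in blast)

lemma cinner_adj: "T \<in> bounded_ops \<Longrightarrow> cinner (T x) y = cinner x (adj T y)"
  using adjoint_exists[of T] adj_eqI by metis

lemma inner_adj: "T \<in> bounded_ops \<Longrightarrow> inner (T x) y = inner x (adj T y)"
  by (simp add: inner_eq_Re_cinner cinner_adj)

lemma adj_scaleR:
  fixes T :: "'a::complex_hilbert_space \<Rightarrow>\<^sub>L 'a"
  assumes "T \<in> bounded_ops"
  shows "adj (r *\<^sub>R T) = r *\<^sub>R adj T"
proof (rule adj_eqI)
  fix x y
  have "cinner z (r *\<^sub>R w) = of_real r * cinner z w" for z w :: 'a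
    by (simp add: scaleR_scaleC cinner_scaleC_right)
  then show "cinner ((r *\<^sub>R T) x) y = cinner x ((r *\<^sub>R adj T) y)"
    using assms by (simp add: blinfun.scaleR_left cinner_scaleR_left cinner_adj)
qed

section \<open>The row norm\<close>

lemma row_norm_nonneg: "0 \<le> row_norm X"
  by (simp add: row_norm_def)

lemma row_norm_scaleR:
  assumes "\<And>i. X i \<in> bounded_ops" "0 \<le> r"
  shows "row_norm (\<lambda>i. r *\<^sub>R X i) = r * row_norm X"
proof -
  have "(r *\<^sub>R X i) o\<^sub>L adj (r *\<^sub>R X i) = r\<^sup>2 *\<^sub>R (X i o\<^sub>L adj (X i))" for i
    by (rule blinfun_eqI)
      (simp add: adj_scaleR assms blinfun.scaleR_left blinfun.scaleR_right power2_eq_square)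
  then show ?thesis
    using assms(2) by (simp add: row_norm_def scaleR_right.sum[symmetric] real_sqrt_mult)
qed

text \<open>Each \<open>X i o\<^sub>L adj (X i)\<close> is positive, so the quadratic form of their
  sum dominates the squared norm of every \<open>adj (X i) y\<close>.\<close>

lemma norm_le_row_norm:
  assumes X: "\<And>i. X i \<in> bounded_ops"
  shows "norm (X i) \<le> row_norm X"
proof -
  define S where "S = (\<Sum>i\<in>UNIV. X i o\<^sub>L adj (X i))"
  have adj_le: "norm (adj (X i) y) \<le> row_norm X * norm y" for y
  proof -
    have "(norm (adj (X i) y))\<^sup>2 \<le> (\<Sum>i\<in>UNIV. (norm (adj (X i) y))\<^sup>2)"
      by (rule member_le_sum) auto
    also have "\<dots> = inner (S y) y"
      by (simp add: S_def blinfun.sum_left inner_sum_left inner_adj X power2_norm_eq_inner)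
    also have "\<dots> \<le> norm (S y) * norm y"
      using Cauchy_Schwarz_ineq2 abs_le_D1 by blast
    also have "\<dots> \<le> norm S * norm y * norm y"
      by (intro mult_right_mono norm_blinfun) simp
    also have "\<dots> = (row_norm X * norm y)\<^sup>2"
      by (simp add: row_norm_def S_def power_mult_distrib) (simp add: power2_eq_square)
    finally show ?thesis
      by (rule power2_le_imp_le) (simp add: row_norm_def)
  qed
  show ?thesis
  proof (rule norm_blinfun_bound)
    fix x
    \<comment> \<open>The bound on the adjoint returns to \<open>X i\<close> through Cauchy-Schwarz,
      after cancelling one factor \<open>norm (X i x)\<close>.\<close>
    have "norm (X i x) * norm (X i x) = inner x (adj (X i) (X i x))"
      by (simp add: norm_eq_sqrt_inner X flip: inner_adj)
    also have "\<dots> \<le> norm x * norm (adj (X i) (X i x))"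
      using Cauchy_Schwarz_ineq2 abs_le_D1 by blast
    also have "\<dots> \<le> norm x * (row_norm X * norm (X i x))"
      by (intro mult_left_mono adj_le) simp
    finally have "norm (X i x) * norm (X i x) \<le> (row_norm X * norm x) * norm (X i x)"
      by (simp add: mult_ac)
    then show "norm (X i x) \<le> row_norm X * norm x"
      by (cases "X i x = 0") (auto simp: row_norm_def)
  qed (simp add: row_norm_def)
qed

section \<open>Operators on the tensor product\<close>

lemma subspace_closure:
  fixes S :: "'a::real_normed_vector set"
  assumes "subspace S"
  shows "subspace (closure S)"
proof (rule subspaceI)
  show "0 \<in> closure S"
    using assms closure_subset subspace_0 by blast
next
  fix x y assume "x \<in> closure S" "y \<in> closure S"
  then obtain a b where "\<And>n. a n \<in> S" "a \<longlonglongrightarrow> x" "\<And>n. b n \<in> S" "b \<longlonglongrightarrow> y"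
    unfolding closure_sequential by blast
  then show "x + y \<in> closure S"
    unfolding closure_sequential
    using assms by (intro exI[of _ "\<lambda>n. a n + b n"]) (auto intro: tendsto_add subspace_add)
next
  fix c :: real and x assume "x \<in> closure S"
  then obtain a where "\<And>n. a n \<in> S" "a \<longlonglongrightarrow> x"
    unfolding closure_sequential by blast
  then show "c *\<^sub>R x \<in> closure S"
    unfolding closure_sequential
    using assms
    by (intro exI[of _ "\<lambda>n. c *\<^sub>R a n"]) (auto intro: tendsto_scaleR tendsto_const subspace_scale)
qed

text \<open>Extension by continuity, phrased for a relation: on a span of tensors it is not known
  beforehand that values are well defined, and the norm bound yields this along with
  continuity.\<close>

lemma bounded_linear_of_dense_graph:
  fixes G :: "('a::real_normed_vector \<times> 'b::{real_normed_vector, complete_space}) set"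
  assumes G: "subspace G"
    and bound: "\<And>u v. (u, v) \<in> G \<Longrightarrow> norm v \<le> K * norm u"
    and dense: "closure (fst ` G) = UNIV"
    and K: "0 \<le> K"
  obtains T :: "'a \<Rightarrow>\<^sub>L 'b" where "norm T \<le> K" "\<And>u v. (u, v) \<in> G \<Longrightarrow> T u = v"
proof -
  have H: "subspace (closure G)"
    using G by (rule subspace_closure)
  have "closure G \<subseteq> {p. norm (snd p) \<le> K * norm (fst p)}"
    using bound by (intro closure_minimal closed_Collect_le continuous_intros) auto
  then have boundH: "norm v \<le> K * norm u" if "(u, v) \<in> closure G" for u v
    using that by auto
  have "\<exists>v. (u, v) \<in> closure G" for u
  proof -
    obtain a where a: "\<And>n. a n \<in> fst ` G" "a \<longlonglongrightarrow> u"
      using dense closure_sequential[of u "fst ` G"] by auto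
    then have "\<forall>n. \<exists>v. (a n, v) \<in> G"
      by force
    then obtain b where b: "\<And>n. (a n, b n) \<in> G"
      by metis
    have "Cauchy b"
    proof (rule metric_CauchyI)
      fix e :: real assume "0 < e"
      \<comment> \<open>\<open>K + 1\<close> instead of \<open>K\<close> keeps the denominator
        positive when \<open>K = 0\<close>.\<close>
      then have "0 < e / (K + 1)" using K by simp
      then obtain N where N: "\<And>i j. N \<le> i \<Longrightarrow> N \<le> j \<Longrightarrow> dist (a i) (a j) < e / (K + 1)"
        using metric_CauchyD[OF LIMSEQ_imp_Cauchy[OF a(2)]] by metis
      have "dist (b i) (b j) < e" if "N \<le> i" "N \<le> j" for i j
      proof -
        have "(a i - a j, b i - b j) \<in> G"
          using subspace_diff[OF G b b, of i j] by simp
        then have "dist (b i) (b j) \<le> K * dist (a i) (a j)"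
          unfolding dist_norm by (rule bound)
        also have "\<dots> \<le> (K + 1) * dist (a i) (a j)"
          by (intro mult_right_mono) auto
        also have "\<dots> < (K + 1) * (e / (K + 1))"
          using N[OF that] K by (intro mult_strict_left_mono) auto
        finally show ?thesis using K by simp
      qed
      then show "\<exists>N. \<forall>i\<ge>N. \<forall>j\<ge>N. dist (b i) (b j) < e"
        by blast
    qed
    then obtain v where "b \<longlonglongrightarrow> v"
      using Cauchy_convergent convergent_def by blast
    then have "(\<lambda>n. (a n, b n)) \<longlonglongrightarrow> (u, v)"
      using a(2) by (intro tendsto_Pair)
    then show ?thesis
      unfolding closure_sequential using b by (intro exI conjI allI)
  qed
  then obtain T where T: "\<And>u. (u, T u) \<in> closure G"
    by metis
  \<comment> \<open>Two values over the same \<open>u\<close> differ by a value over 0, which the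
    bound forces to be 0.\<close>
  have uniq: "v = T u" if "(u, v) \<in> closure G" for u v
    using boundH[of 0 "v - T u"] subspace_diff[OF H that T[of u]] by simp
  have "bounded_linear T"
  proof (rule bounded_linear_intro)
    show "T (x + y) = T x + T y" for x y
      using subspace_add[OF H T[of x] T[of y]] by (intro uniq[symmetric]) simp
    show "T (r *\<^sub>R x) = r *\<^sub>R T x" for r x
      using subspace_scale[OF H T[of x], of r] by (intro uniq[symmetric]) simp
    show "norm (T x) \<le> norm x * K" for x
      using boundH[OF T] by (simp add: mult.commute)
  qed
  then have app: "blinfun_apply (Blinfun T) = T"
    by (rule bounded_linear_Blinfun_apply)
  show thesis
  proof (rule that[of "Blinfun T"])
    show "norm (Blinfun T) \<le> K"
      using boundH[OF T] K by (intro norm_blinfun_bound) (auto simp: app)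
    show "Blinfun T u = v" if "(u, v) \<in> G" for u v
      using that closure_subset uniq app by (metis subsetD)
  qed
qed

section \<open>Tensoring an operator with the identity\<close>

context
  fixes tens :: "'k::complex_hilbert_space \<Rightarrow> 'h::complex_hilbert_space \<Rightarrow> 'kh::complex_hilbert_space"
  assumes tens: "hilbert_tensor tens"
begin

lemma clinear_tens_left: "clinear (\<lambda>x. tens x y)"
  using tens by (simp add: hilbert_tensor_def)

lemma clinear_tens_right: "clinear (tens x)"
  using tens by (simp add: hilbert_tensor_def)

lemma cinner_tens: "cinner (tens x y) (tens x' y') = cinner x x' * cinner y y'"
  using tens by (simp add: hilbert_tensor_def)

lemma norm_tens: "norm (tens x y) = norm x * norm y"
proof -
  have "(of_real ((norm (tens x y))\<^sup>2) :: complex) = of_real ((norm x * norm y)\<^sup>2)"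
    by (simp only: cinner_self[symmetric] cinner_tens power_mult_distrib of_real_mult)
  then show ?thesis
    unfolding of_real_eq_iff by (simp add: power2_eq_iff_nonneg)
qed

text \<open>A complex scalar can be absorbed into the first factor, so the real span already
  contains the complex one. This makes real-linear density arguments available.\<close>

lemma closure_span_tens: "closure (span (range (\<lambda>(x, y). tens x y))) = UNIV"
proof -
  let ?S = "range (\<lambda>(x, y). tens x y)"
  have scale: "c *\<^sub>C u \<in> span ?S" if "u \<in> span ?S" for c u
    using that
  proof (induction rule: span_induct_alt)
    case base
    then show ?case
      using scaleC_add_right[of c 0 0] by (simp add: span_zero)
  next
    case (step r s u)
    then obtain x y where s: "s = tens x y" by auto
    have "c *\<^sub>C (r *\<^sub>R s + u) = r *\<^sub>R tens (c *\<^sub>C x) y + c *\<^sub>C u"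
      by (simp add: s scaleC_add_right scaleR_scaleC scaleC_scaleC mult.commute
          clinear_scaleC[OF clinear_tens_left])
    moreover have "tens (c *\<^sub>C x) y \<in> span ?S"
      by (rule span_base) auto
    ultimately show ?case
      using step by (simp add: span_add span_scale)
  qed
  have "complex_vector.subspace (span ?S)"
    by (rule complex_vector.subspaceI) (auto simp: span_zero span_add scale)
  then have "cspan ?S \<subseteq> span ?S"
    by (intro complex_vector.span_minimal span_superset)
  then show ?thesis
    using tens closure_mono[of "cspan ?S" "span ?S"] by (auto simp: hilbert_tensor_def)
qed

lemma blinfun_eq_tensI:
  fixes S T :: "'kh \<Rightarrow>\<^sub>L 'kh"
  assumes "\<And>x y. S (tens x y) = T (tens x y)"
  shows "S = T"
proof (rule blinfun_eqI)
  fix u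
  have "span (range (\<lambda>(x, y). tens x y)) \<subseteq> {u. S u = T u}"
    using assms
    by (intro span_minimal subspaceI) (auto simp: blinfun.add_right blinfun.scaleR_right)
  then have "closure (span (range (\<lambda>(x, y). tens x y))) \<subseteq> {u. S u = T u}"
    by (intro closure_minimal closed_Collect_eq continuous_intros)
  then show "S u = T u"
    using closure_span_tens by auto
qed

text \<open>Orthogonality of the second factors alone kills the cross terms; the \<open>a f\<close>
  are arbitrary.\<close>

lemma norm_sum_tens_orthonormal:
  assumes "orthonormal F" "finite F"
  shows "(norm (\<Sum>f\<in>F. tens (a f) f))\<^sup>2 = (\<Sum>f\<in>F. (norm (a f))\<^sup>2)"
proof -
  have "complex_of_real ((norm (\<Sum>f\<in>F. tens (a f) f))\<^sup>2) =
      (\<Sum>f\<in>F. \<Sum>g\<in>F. cinner (a f) (a g) * cinner f g)"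
    unfolding cinner_self[symmetric] cinner_sum_left cinner_sum_right cinner_tens
    by (rule sum.swap)
  also have "\<dots> = (\<Sum>f\<in>F. \<Sum>g\<in>F. if f = g then cinner (a f) (a f) else 0)"
    using assms(1) by (intro sum.cong) (auto simp: orthonormal_def)
  also have "\<dots> = complex_of_real (\<Sum>f\<in>F. (norm (a f))\<^sup>2)"
    using assms(2) by (simp add: cinner_self)
  finally show ?thesis
    unfolding of_real_eq_iff .
qed

text \<open>
  Writing a finite sum of elementary tensors over orthonormal second factors makes the bound
  \<open>\<parallel>B \<otimes> I\<parallel> \<le> \<parallel>B\<parallel>\<close> an instance of the Pythagorean theorem.
\<close>

lemma tensor_graph_orthonormal:
  fixes B :: "'k \<Rightarrow>\<^sub>L 'k"
  assumes B: "B \<in> bounded_ops"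
    and p: "p \<in> span (range (\<lambda>(x, y). (tens x y, tens (B x) y)))"
  shows "\<exists>F a. orthonormal F \<and> finite F \<and>
    p = (\<Sum>f\<in>F. (tens (a f) f, tens (B (a f)) f))"
  using p
proof (induction rule: span_induct_alt)
  case base
  show ?case
    by (rule exI[of _ "{}"]) (simp add: orthonormal_def)
next
  case (step c s q)
  then obtain x y F a where s: "s = (tens x y, tens (B x) y)"
    and F: "orthonormal F" "finite F" and q: "q = (\<Sum>f\<in>F. (tens (a f) f, tens (B (a f)) f))"
    by auto
  obtain F' where F': "orthonormal F'" "finite F'" "F \<subseteq> F'" "y = (\<Sum>f\<in>F'. cinner y f *\<^sub>C f)"
    using orthonormal_extend[OF F] by blast
  \<comment> \<open>Expanding \<open>y\<close> over \<open>F'\<close> adds a multiple of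
    \<open>x\<close> to each coefficient; old coefficients are extended by 0 outside
    \<open>F\<close>.\<close>
  define b where "b f = (if f \<in> F then a f else 0) + cinner y f *\<^sub>C c *\<^sub>R x" for f
  \<comment> \<open>A general \<open>L\<close> treats both components of the graph at once: the
    identity for the first, \<open>B\<close> for the second.\<close>
  have *: "(\<Sum>f\<in>F'. tens (L (b f)) f) = c *\<^sub>R tens (L x) y + (\<Sum>f\<in>F. tens (L (a f)) f)"
    if L: "clinear L" for L
  proof -
    have "(\<Sum>f\<in>F'. tens (L (b f)) f) =
        (\<Sum>f\<in>F'. if f \<in> F then tens (L (a f)) f else 0) +
        (\<Sum>f\<in>F'. c *\<^sub>R tens (L x) (cinner y f *\<^sub>C f))"
      unfolding sum.distrib[symmetric]
      by (intro sum.cong refl)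
        (simp add: b_def clinear_add[OF L] clinear_scaleC[OF L] clinear_scaleR[OF L]
          clinear_zero[OF L] clinear_add[OF clinear_tens_left] clinear_scaleC[OF clinear_tens_left]
          clinear_scaleR[OF clinear_tens_left] clinear_zero[OF clinear_tens_left]
          clinear_scaleC[OF clinear_tens_right] scaleR_scaleC scaleC_scaleC mult.commute)
    also have "(\<Sum>f\<in>F'. c *\<^sub>R tens (L x) (cinner y f *\<^sub>C f)) =
        c *\<^sub>R tens (L x) (\<Sum>f\<in>F'. cinner y f *\<^sub>C f)"
      by (simp add: clinear_sum[OF clinear_tens_right] scaleR_right.sum)
    also have "\<dots> = c *\<^sub>R tens (L x) y"
      using F'(4) by simp
    also have "(\<Sum>f\<in>F'. if f \<in> F then tens (L (a f)) f else 0) = (\<Sum>f\<in>F. tens (L (a f)) f)"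
      using F' by (simp add: sum.If_cases Int_absorb1)
    finally show ?thesis by simp
  qed
  have "clinear (\<lambda>x :: 'k. x)" "clinear B"
    using B by (auto intro: clinearI simp: bounded_ops_def)
  from *[OF this(1)] *[OF this(2)] have "c *\<^sub>R s + q = (\<Sum>f\<in>F'. (tens (b f) f, tens (B (b f)) f))"
    by (simp add: s q sum_prod)
  then show ?case
    using F' by blast
qed

text \<open>The graph of \<open>B\<close> \<otimes> I is spanned by its pairs at elementary tensors;
  the orthonormal form bounds it, and density extends it.\<close>

lemma tensor_left_exists:
  fixes B :: "'k \<Rightarrow>\<^sub>L 'k"
  assumes B: "B \<in> bounded_ops"
  shows "\<exists>T :: 'kh \<Rightarrow>\<^sub>L 'kh. norm T \<le> norm B \<and> (\<forall>x y. blinfun_apply T (tens x y) = tens (B x) y)"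
proof -
  let ?R = "range (\<lambda>(x, y). (tens x y, tens (B x) y))"
  have bound: "norm v \<le> norm B * norm u" if "(u, v) \<in> span ?R" for u v
  proof -
    obtain F a where F: "orthonormal F" "finite F"
      and uv: "(u, v) = (\<Sum>f\<in>F. (tens (a f) f, tens (B (a f)) f))"
      using tensor_graph_orthonormal[OF B \<open>(u, v) \<in> span ?R\<close>] by blast
    then have u: "u = (\<Sum>f\<in>F. tens (a f) f)" and v: "v = (\<Sum>f\<in>F. tens (B (a f)) f)"
      by (simp_all add: sum_prod)
    have "(norm v)\<^sup>2 = (\<Sum>f\<in>F. (norm (B (a f)))\<^sup>2)"
      unfolding v by (rule norm_sum_tens_orthonormal[OF F])
    also have "\<dots> \<le> (\<Sum>f\<in>F. (norm B)\<^sup>2 * (norm (a f))\<^sup>2)"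
      by (intro sum_mono) (metis norm_blinfun norm_ge_zero power_mono power_mult_distrib)
    also have "\<dots> = (norm B * norm u)\<^sup>2"
      unfolding u by (simp add: power_mult_distrib norm_sum_tens_orthonormal[OF F] sum_distrib_left)
    finally show ?thesis
      by (rule power2_le_imp_le) simp
  qed
  have "fst ` span ?R = span (fst ` ?R)"
    by (rule linear_span_image[symmetric]) (simp add: bounded_linear.linear bounded_linear_fst)
  also have "fst ` ?R = range (\<lambda>(x, y). tens x y)"
    by force
  finally have dense: "closure (fst ` span ?R) = UNIV"
    by (simp add: closure_span_tens)
  show ?thesis
  proof (rule bounded_linear_of_dense_graph[OF subspace_span bound dense norm_ge_zero])
    fix T assume T: "norm T \<le> norm B" "\<And>u v. (u, v) \<in> span ?R \<Longrightarrow> blinfun_apply T u = v"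
    have "T (tens x y) = tens (B x) y" for x y
      by (intro T(2) span_base) auto
    with T(1) show ?thesis by blast
  qed
qed

end

text \<open>Exchanging the factors turns the construction of \<open>B\<close> \<otimes> I into one
  of I \<otimes> \<open>X\<close>.\<close>

lemma hilbert_tensor_flip:
  fixes tens :: "'k::complex_hilbert_space \<Rightarrow> 'h::complex_hilbert_space \<Rightarrow> 'kh::complex_hilbert_space"
  assumes "hilbert_tensor tens"
  shows "hilbert_tensor (\<lambda>y x. tens x y)"
proof -
  have "range (\<lambda>(y, x). tens x y) = range (\<lambda>(x, y). tens x y)"
    by force
  then show ?thesis
    using assms by (simp add: hilbert_tensor_def mult.commute)
qed

context
  fixes tens :: "'k::complex_hilbert_space \<Rightarrow> 'h::complex_hilbert_space \<Rightarrow> 'kh::complex_hilbert_space"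
    and B :: "'k \<Rightarrow>\<^sub>L 'k" and X :: "'h \<Rightarrow>\<^sub>L 'h"
  assumes tens: "hilbert_tensor tens" and B: "B \<in> bounded_ops" and X: "X \<in> bounded_ops"
begin

text \<open>\<open>B\<close> \<otimes> \<open>X\<close> is the composition of \<open>B\<close>
  \<otimes> I and I \<otimes> \<open>X\<close>; density of elementary tensors makes it the unique
  operator described by \<open>tensor_op\<close>.\<close>

lemma tensor_op_properties:
  "norm (tensor_op tens B X) \<le> norm B * norm X"
  "tensor_op tens B X (tens x y) = tens (B x) (X y)"
proof -
  obtain T :: "'kh \<Rightarrow>\<^sub>L 'kh" where T: "norm T \<le> norm B" "\<And>x y. T (tens x y) = tens (B x) y"
    using tensor_left_exists[OF tens B] by blast
  obtain S :: "'kh \<Rightarrow>\<^sub>L 'kh" where S: "norm S \<le> norm X" "\<And>x y. S (tens x y) = tens x (X y)"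
    using tensor_left_exists[OF hilbert_tensor_flip[OF tens] X] by blast
  have eq: "tensor_op tens B X = T o\<^sub>L S"
    unfolding tensor_op_def
    by (rule the_equality) (auto simp: T S intro: blinfun_eq_tensI[OF tens])
  have "norm (T o\<^sub>L S) \<le> norm T * norm S"
    by (rule norm_blinfun_compose)
  also have "\<dots> \<le> norm B * norm X"
    using T S by (intro mult_mono) auto
  finally show "norm (tensor_op tens B X) \<le> norm B * norm X"
    by (simp add: eq)
  show "tensor_op tens B X (tens x y) = tens (B x) (X y)"
    by (simp add: eq T S)
qed

end

lemma tensor_op_zero_left:
  assumes "hilbert_tensor tens" "X \<in> bounded_ops"
  shows "tensor_op tens 0 X = 0"
  using tensor_op_properties(1)[OF assms(1) zero_bounded_ops assms(2)] by simp

lemma tensor_op_zero_right: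
  assumes "hilbert_tensor tens" "B \<in> bounded_ops"
  shows "tensor_op tens B 0 = 0"
  using tensor_op_properties(1)[OF assms zero_bounded_ops] by simp

section \<open>Words in operators\<close>

lemma word_op_Nil [simp]: "word_op X [] = id_blinfun"
  by (simp add: word_op_def)

lemma word_op_Cons [simp]: "word_op X (i # \<beta>) = X i o\<^sub>L word_op X \<beta>"
  by (simp add: word_op_def)

lemma word_op_bounded_ops:
  assumes "\<And>i. X i \<in> bounded_ops"
  shows "word_op X \<beta> \<in> bounded_ops"
proof (induction \<beta>)
  case Nil
  show ?case by (auto simp: bounded_ops_def intro: clinearI)
next
  case (Cons i \<beta>)
  then show ?case
    using assms[of i]
    by (auto simp: bounded_ops_def clinear_add clinear_scaleC intro!: clinearI)
qed

lemma norm_word_op_le: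
  assumes "\<And>i. X i \<in> bounded_ops"
  shows "norm (word_op X \<beta>) \<le> row_norm X ^ length \<beta>"
proof (induction \<beta>)
  case Nil
  show ?case by (simp add: norm_blinfun_id_le)
next
  case (Cons i \<beta>)
  have "norm (word_op X (i # \<beta>)) \<le> norm (X i) * norm (word_op X \<beta>)"
    by (simp add: norm_blinfun_compose)
  also have "\<dots> \<le> row_norm X * row_norm X ^ length \<beta>"
    using Cons norm_le_row_norm[of X, OF assms]
    by (intro mult_mono) (auto simp: row_norm_nonneg)
  finally show ?case by simp
qed

lemma word_op_scaleR: "word_op (\<lambda>i. r *\<^sub>R X i) \<beta> = r ^ length \<beta> *\<^sub>R word_op X \<beta>"
  by (induction \<beta>)
    (auto intro!: blinfun_eqI simp: blinfun.scaleR_left blinfun.scaleR_right mult_ac)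

lemma finite_words: "finite {\<alpha> :: 'n::finite list. length \<alpha> = k}"
  using finite_lists_length_eq[of "UNIV :: 'n set" k] by simp

section \<open>The nilpotent tuple attached to a word\<close>

definition word_shift :: "(nat \<Rightarrow> 'h::complex_hilbert_space) \<Rightarrow> 'n list \<Rightarrow> 'n \<Rightarrow> ('h \<Rightarrow>\<^sub>L 'h)"
  where "word_shift e \<alpha> i =
    Blinfun (\<lambda>y. \<Sum>j | j < length \<alpha> \<and> \<alpha> ! j = i. cinner y (e (Suc j)) *\<^sub>C e j)"

context
  fixes e :: "nat \<Rightarrow> 'h::complex_hilbert_space" and \<alpha> :: "'n list"
  assumes e: "\<And>i j. i \<le> length \<alpha> \<Longrightarrow> j \<le> length \<alpha> \<Longrightarrow> cinner (e i) (e j) = (if i = j then 1 else 0)"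
begin

lemma word_shift_apply:
  "word_shift e \<alpha> i y = (\<Sum>j | j < length \<alpha> \<and> \<alpha> ! j = i. cinner y (e (Suc j)) *\<^sub>C e j)"
proof -
  \<comment> \<open>Without this, \<open>Blinfun\<close> would not return the given map. Splitting
    into real and imaginary parts reduces it to real bounded linearity.\<close>
  have "bounded_linear (\<lambda>y. \<Sum>j | j < length \<alpha> \<and> \<alpha> ! j = i. cinner y (e (Suc j)) *\<^sub>C e j)"
    unfolding cinner_eq_inner
    by (subst scaleC_eq_scaleR) (auto intro!: bounded_linear_intros)
  then show ?thesis
    unfolding word_shift_def by (simp add: bounded_linear_Blinfun_apply)
qed

lemma word_shift_bounded_ops: "word_shift e \<alpha> i \<in> bounded_ops"
  unfolding bounded_ops_def
  by (auto intro!: clinearI simp: word_shift_apply cinner_add_left scaleC_add_left sum.distrib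
      cinner_scaleC_left complex_vector.scale_sum_right scaleC_scaleC)

lemma cinner_word_shift:
  assumes "j \<le> length \<alpha>"
  shows "cinner (word_shift e \<alpha> i y) (e j) =
    (if j < length \<alpha> \<and> \<alpha> ! j = i then cinner y (e (Suc j)) else 0)"
proof -
  have "cinner (word_shift e \<alpha> i y) (e j) =
      (\<Sum>l | l < length \<alpha> \<and> \<alpha> ! l = i. if l = j then cinner y (e (Suc j)) else 0)"
    unfolding word_shift_apply cinner_sum_left cinner_scaleC_left
    using assms by (intro sum.cong) (auto simp: e)
  then show ?thesis by simp
qed

text \<open>The first letter acts last, so peeling it off moves the tested index from
  \<open>j\<close> to \<open>j + 1\<close>. The component survives exactly when
  \<open>\<beta>\<close> occurs in \<open>\<alpha>\<close> at position \<open>j\<close>.\<close>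

lemma cinner_word_op_shift:
  "j \<le> length \<alpha> \<Longrightarrow> cinner (word_op (word_shift e \<alpha>) \<beta> y) (e j) =
    (if j + length \<beta> \<le> length \<alpha> \<and> take (length \<beta>) (drop j \<alpha>) = \<beta>
     then cinner y (e (j + length \<beta>)) else 0)"
proof (induction \<beta> arbitrary: j)
  case (Cons i \<beta>)
  show ?case
  proof (cases "j < length \<alpha>")
    case True
    then have "drop j \<alpha> = \<alpha> ! j # drop (Suc j) \<alpha>"
      by (simp add: Cons_nth_drop_Suc)
    then show ?thesis
      using True Cons.IH[of "Suc j"] by (auto simp: cinner_word_shift)
  qed (use Cons.prems in \<open>auto simp: cinner_word_shift\<close>)
qed simp

text \<open>The outermost shift sees only components at \<open>e (Suc j)\<close>, and the remaining
  word is too long to fit into \<open>\<alpha>\<close> from position \<open>j + 1\<close>.\<close>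

lemma word_op_shift_eq_0:
  assumes "length \<alpha> < length \<beta>"
  shows "word_op (word_shift e \<alpha>) \<beta> = 0"
proof (rule blinfun_eqI)
  fix y
  obtain i \<gamma> where \<beta>: "\<beta> = i # \<gamma>"
    using assms by (cases \<beta>) auto
  then have "cinner (word_op (word_shift e \<alpha>) \<gamma> y) (e (Suc j)) = 0" if "j < length \<alpha>" for j
    using assms that by (subst cinner_word_op_shift) auto
  then show "word_op (word_shift e \<alpha>) \<beta> y = blinfun_apply 0 y"
    by (simp add: \<beta> word_shift_apply)
qed

end

section \<open>Growth of the evaluated series\<close>

lemma cinner_free_eval_shift:
  fixes tens :: "'k::complex_hilbert_space \<Rightarrow> 'h::complex_hilbert_space \<Rightarrow> 'kh::complex_hilbert_space"
    and A :: "'n::finite list \<Rightarrow> ('k \<Rightarrow>\<^sub>L 'k)"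
  assumes tens: "hilbert_tensor tens"
    and A: "\<And>\<beta>. A \<beta> \<in> bounded_ops"
    and e: "\<And>i j. i \<le> length \<alpha> \<Longrightarrow> j \<le> length \<alpha> \<Longrightarrow> cinner (e i) (e j) = (if i = j then 1 else 0)"
  shows "cinner (free_eval tens A (\<lambda>i. r *\<^sub>R word_shift e \<alpha> i) (tens x (e (length \<alpha>)))) (tens y (e 0)) =
    of_real (r ^ length \<alpha>) * cinner (A \<alpha> x) y"
proof -
  define X where "X = (\<lambda>i. r *\<^sub>R word_shift e \<alpha> i)"
  define c where "c = of_real (r ^ length \<alpha>) * cinner (A \<alpha> x) y"
  define T where "T \<beta> = tensor_op tens (A \<beta>) (word_op X \<beta>)" for \<beta>
  have X: "X i \<in> bounded_ops" for i
    unfolding X_def by (intro bounded_ops_scaleR word_shift_bounded_ops e)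
  have word: "word_op X \<beta> = r ^ length \<beta> *\<^sub>R word_op (word_shift e \<alpha>) \<beta>" for \<beta>
    unfolding X_def by (rule word_op_scaleR)
  have zero: "T \<beta> = 0" if "length \<alpha> < length \<beta>" for \<beta>
    using that by (simp add: T_def word word_op_shift_eq_0[OF e] tensor_op_zero_right[OF tens A])
  \<comment> \<open>Vanishing of the long words makes the series finite, so its value needs no
    convergence argument.\<close>
  have eval: "free_eval tens A X = (\<Sum>l\<le>length \<alpha>. \<Sum>\<beta> | length \<beta> = l. T \<beta>)"
    unfolding free_eval_def T_def[symmetric]
    by (rule suminf_finite) (auto intro!: sum.neutral zero)
  have coeff: "cinner (T \<beta> (tens x (e (length \<alpha>)))) (tens y (e 0)) = (if \<beta> = \<alpha> then c else 0)" for \<beta>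
  proof -
    have "cinner (T \<beta> (tens x (e (length \<alpha>)))) (tens y (e 0)) =
        cinner (A \<beta> x) y * cinner (word_op X \<beta> (e (length \<alpha>))) (e 0)"
      unfolding T_def
      by (simp add: tensor_op_properties(2)[OF tens A word_op_bounded_ops[OF X]] cinner_tens[OF tens])
    \<comment> \<open>At position 0 only prefixes of \<open>\<alpha>\<close> match, and a proper
      prefix contributes the inner product of two distinct basis vectors, which is 0.\<close>
    also have "cinner (word_op X \<beta> (e (length \<alpha>))) (e 0) =
        of_real (r ^ length \<beta>) * (if \<beta> = \<alpha> then 1 else 0)"
      by (auto simp: word blinfun.scaleR_left cinner_scaleR_left cinner_word_op_shift[OF e] e)
    finally show ?thesis
      by (simp add: c_def mult.commute)
  qed
  have "cinner (free_eval tens A X (tens x (e (length \<alpha>)))) (tens y (e 0)) =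
      (\<Sum>l\<le>length \<alpha>. \<Sum>\<beta> | length \<beta> = l. if \<beta> = \<alpha> then c else 0)"
    by (simp only: eval blinfun.sum_left cinner_sum_left coeff)
  also have "\<dots> = (\<Sum>l\<le>length \<alpha>. if length \<alpha> = l then c else 0)"
    by (simp add: finite_words)
  also have "\<dots> = c"
    by simp
  finally show ?thesis
    by (simp only: X_def c_def)
qed

text \<open>For row norm at least 1 the \<open>m\<close>-th power dominates all lower ones, so the
  finitely many terms are bounded separately.\<close>

lemma polynomial_imp_growth:
  fixes tens :: "'k::complex_hilbert_space \<Rightarrow> 'h::complex_hilbert_space \<Rightarrow> 'kh::complex_hilbert_space"
    and A :: "'n::finite list \<Rightarrow> ('k \<Rightarrow>\<^sub>L 'k)"
  assumes tens: "hilbert_tensor tens"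
    and A: "\<And>\<beta>. A \<beta> \<in> bounded_ops"
    and poly: "polynomial_degree_le A m"
    and X: "\<And>i. X i \<in> bounded_ops"
    and large: "1 \<le> row_norm X"
  shows "norm (free_eval tens A X) \<le> (\<Sum>k\<le>m. \<Sum>\<alpha> | length \<alpha> = k. norm (A \<alpha>)) * row_norm X ^ m"
proof -
  define T where "T \<beta> = tensor_op tens (A \<beta>) (word_op X \<beta>)" for \<beta>
  have zero: "T \<beta> = 0" if "m < length \<beta>" for \<beta>
    using that poly
    by (simp add: T_def polynomial_degree_le_def tensor_op_zero_left[OF tens word_op_bounded_ops[OF X]])
  have "free_eval tens A X = (\<Sum>k\<le>m. \<Sum>\<beta> | length \<beta> = k. T \<beta>)"
    unfolding free_eval_def T_def[symmetric]
    by (rule suminf_finite) (auto intro!: sum.neutral zero)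
  also have "norm \<dots> \<le> (\<Sum>k\<le>m. \<Sum>\<beta> | length \<beta> = k. norm (A \<beta>) * row_norm X ^ m)"
  proof (intro sum_norm_le)
    fix k and \<beta> :: "'n list" assume "k \<in> {..m}" "\<beta> \<in> {\<beta>. length \<beta> = k}"
    then have "norm (word_op X \<beta>) \<le> row_norm X ^ m"
      using order_trans[OF norm_word_op_le[OF X] power_increasing[OF _ large]] by simp
    then show "norm (T \<beta>) \<le> norm (A \<beta>) * row_norm X ^ m"
      unfolding T_def
      by (rule order_trans[OF tensor_op_properties(1)[OF tens A word_op_bounded_ops[OF X]]
            mult_left_mono]) simp
  qed
  finally show ?thesis
    by (simp add: sum_distrib_right)
qed

text \<open>Choosing \<open>A \<alpha> x\<close> as the test vector \<open>y\<close> makes the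
  matrix coefficient \<open>r ^ length \<alpha>\<close> times the squared norm of
  \<open>A \<alpha> x\<close>, which outgrows order \<open>r ^ m\<close> unless that norm is
  0.\<close>

lemma growth_imp_coeff_eq_0:
  fixes tens :: "'k::complex_hilbert_space \<Rightarrow> 'h::complex_hilbert_space \<Rightarrow> 'kh::complex_hilbert_space"
    and A :: "'n::finite list \<Rightarrow> ('k \<Rightarrow>\<^sub>L 'k)"
  assumes tens: "hilbert_tensor tens"
    and inf: "infinite_dimensional TYPE('h)"
    and A: "\<And>\<beta>. A \<beta> \<in> bounded_ops"
    and M: "0 < M"
    and growth: "\<And>X :: 'n \<Rightarrow> ('h \<Rightarrow>\<^sub>L 'h). (\<And>i. X i \<in> bounded_ops) \<Longrightarrow> C \<le> row_norm X \<Longrightarrow>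
      norm (free_eval tens A X) \<le> M * row_norm X ^ m"
    and long: "m < length \<alpha>"
  shows "A \<alpha> = 0"
proof (rule blinfun_eqI)
  fix x
  obtain F :: "'h set" where F: "orthonormal F" "finite F" "Suc (length \<alpha>) \<le> card F"
    using infinite_dimensional_orthonormal[OF inf] by blast
  obtain e where bij: "bij_betw e {0..<card F} F"
    using ex_bij_betw_nat_finite[OF F(2)] by blast
  have e: "cinner (e i) (e j) = (if i = j then 1 else 0)" if "i \<le> length \<alpha>" "j \<le> length \<alpha>" for i j
  proof -
    have "i \<in> {0..<card F}" "j \<in> {0..<card F}"
      using that F(3) by auto
    moreover from this have "e i \<in> F" "e j \<in> F" "e i = e j \<longleftrightarrow> i = j"
      using bij by (auto simp: bij_betw_def inj_on_eq_iff)
    ultimately show ?thesis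
      using F(1) by (simp add: orthonormal_def)
  qed
  have unit: "norm (e j) = 1" if "j \<le> length \<alpha>" for j
  proof -
    have "complex_of_real ((norm (e j))\<^sup>2) = of_real 1"
      using e[OF that that] by (simp add: cinner_self)
    then show ?thesis
      unfolding of_real_eq_iff using power2_eq_iff_nonneg[of "norm (e j)" 1] by simp
  qed
  define X where "X = word_shift e \<alpha>"
  have X: "X i \<in> bounded_ops" for i
    unfolding X_def by (intro word_shift_bounded_ops e)
  \<comment> \<open>The first letter's operator sends \<open>e 1\<close> to a vector with component
    1 along \<open>e 0\<close>. Hence the row norm is positive and scaling can reach the threshold
    \<open>C\<close>.\<close>
  have "0 < length \<alpha>"
    using long by linarith
  then have "cinner (X (\<alpha> ! 0) (e (Suc 0))) (e 0) = 1"
    by (simp add: X_def cinner_word_shift[OF e] e Suc_le_eq)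
  then have "X (\<alpha> ! 0) \<noteq> 0"
    by auto
  then have "0 < norm (X (\<alpha> ! 0))"
    by simp
  then have \<rho>: "0 < row_norm X"
    using norm_le_row_norm[of X "\<alpha> ! 0"] X by (meson less_le_trans)
  define a where "a = (norm (A \<alpha> x))\<^sup>2"
  \<comment> \<open>\<open>D\<close> collects the factors of the upper bound that do not depend on
    \<open>r\<close>.\<close>
  define D where "D = M * row_norm X ^ m * (norm x * norm (A \<alpha> x))"
  have bound: "r * a \<le> D" if r: "1 \<le> r" "C / row_norm X \<le> r" for r
  proof -
    let ?T = "free_eval tens A (\<lambda>i. r *\<^sub>R X i)"
    have rn: "row_norm (\<lambda>i. r *\<^sub>R X i) = r * row_norm X"
      using r by (intro row_norm_scaleR X) auto
    have "norm ?T \<le> M * (r * row_norm X) ^ m"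
      unfolding rn[symmetric]
    proof (rule growth)
      show "r *\<^sub>R X i \<in> bounded_ops" for i
        by (intro bounded_ops_scaleR X)
      show "C \<le> row_norm (\<lambda>i. r *\<^sub>R X i)"
        using r \<rho> by (simp add: rn field_simps)
    qed
    have "r ^ length \<alpha> * a = inner (?T (tens x (e (length \<alpha>)))) (tens (A \<alpha> x) (e 0))"
      unfolding inner_eq_Re_cinner X_def a_def
      by (subst cinner_free_eval_shift[OF tens A e]) (simp_all add: cinner_self)
    also have "\<dots> \<le> norm (?T (tens x (e (length \<alpha>)))) * norm (tens (A \<alpha> x) (e 0))"
      by (rule norm_cauchy_schwarz)
    also have "\<dots> \<le> (norm ?T * norm (tens x (e (length \<alpha>)))) * norm (tens (A \<alpha> x) (e 0))"
      by (intro mult_right_mono norm_blinfun) simp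
    also have "\<dots> = norm ?T * (norm x * norm (A \<alpha> x))"
      by (simp add: norm_tens[OF tens] unit)
    also have "\<dots> \<le> (M * (r * row_norm X) ^ m) * (norm x * norm (A \<alpha> x))"
      by (intro mult_right_mono \<open>norm ?T \<le> _\<close>) simp
    also have "\<dots> = r ^ m * D"
      by (simp add: D_def power_mult_distrib)
    finally have "r ^ m * (r ^ (length \<alpha> - m) * a) \<le> r ^ m * D"
      using long by (simp add: mult.assoc[symmetric] power_add[symmetric])
    then have "r ^ (length \<alpha> - m) * a \<le> D"
      using r by simp
    \<comment> \<open>One surplus power of \<open>r\<close> suffices, and it is available because
      \<open>length \<alpha> - m\<close> is at least 1.\<close>
    moreover have "r ^ 1 * a \<le> r ^ (length \<alpha> - m) * a"
      using r long by (intro mult_right_mono power_increasing) (auto simp: a_def)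
    ultimately show ?thesis
      by simp
  qed
  have "a \<le> 0"
  proof (rule ccontr)
    assume "\<not> a \<le> 0"
    then have "0 < a" by simp
    \<comment> \<open>The first two terms meet the conditions of \<open>bound\<close>; the third
      pushes \<open>r * a\<close> past \<open>D\<close>.\<close>
    define r where "r = max (max 1 (C / row_norm X)) (D / a + 1)"
    have "D < (D / a + 1) * a"
      using \<open>0 < a\<close> by (simp add: field_simps)
    also have "\<dots> \<le> r * a"
      using \<open>0 < a\<close> by (intro mult_right_mono) (auto simp: r_def)
    also have "\<dots> \<le> D"
      by (rule bound) (auto simp: r_def)
    finally show False by simp
  qed
  then show "A \<alpha> x = blinfun_apply 0 x"
    by (simp add: a_def)
qed

theorem theorem2p2:
  fixes tens :: "'k::complex_hilbert_space \<Rightarrow> 'h::complex_hilbert_space \<Rightarrow> 'kh::complex_hilbert_space"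
    and A :: "'n::finite list \<Rightarrow> ('k \<Rightarrow>\<^sub>L 'k)"
    and m :: nat
  assumes "hilbert_tensor tens"
    and "infinite_dimensional TYPE('h)"
    and "free_entire A"
  shows "polynomial_degree_le A m \<longleftrightarrow>
    (\<exists>M C. M > 0 \<and> C > 1 \<and>
      (\<forall>X :: 'n \<Rightarrow> ('h \<Rightarrow>\<^sub>L 'h). (\<forall>i. X i \<in> bounded_ops) \<and> row_norm X \<ge> C \<longrightarrow>
        norm (free_eval tens A X) \<le> M * row_norm X ^ m))"
proof -
  have A: "A \<alpha> \<in> bounded_ops" for \<alpha>
    using assms(3) by (simp add: free_entire_def)
  show ?thesis
  proof
    assume poly: "polynomial_degree_le A m"
    define M where "M = (\<Sum>k\<le>m. \<Sum>\<alpha> | length \<alpha> = k. norm (A \<alpha>))"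
    have "0 \<le> M"
      unfolding M_def by (intro sum_nonneg) simp
    \<comment> \<open>\<open>M\<close> is 0 when all coefficients up to degree \<open>m\<close>
      vanish, so \<open>M + 1\<close> provides a positive constant; 2 is a convenient threshold
      above 1.\<close>
    have "norm (free_eval tens A X) \<le> (M + 1) * row_norm X ^ m"
      if "\<And>i. X i \<in> bounded_ops" "2 \<le> row_norm X" for X
    proof -
      have "norm (free_eval tens A X) \<le> M * row_norm X ^ m"
        unfolding M_def using that by (intro polynomial_imp_growth assms(1) A poly) auto
      also have "\<dots> \<le> (M + 1) * row_norm X ^ m"
        by (intro mult_right_mono zero_le_power row_norm_nonneg) simp
      finally show ?thesis .
    qed
    with \<open>0 \<le> M\<close> show "\<exists>M C. M > 0 \<and> C > 1 \<and>
        (\<forall>X :: 'n \<Rightarrow> ('h \<Rightarrow>\<^sub>L 'h). (\<forall>i. X i \<in> bounded_ops) \<and> row_norm X \<ge> C \<longrightarrow>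
          norm (free_eval tens A X) \<le> M * row_norm X ^ m)"
      by (intro exI[of _ "M + 1"] exI[of _ 2]) auto
  next
    assume "\<exists>M C. M > 0 \<and> C > 1 \<and>
        (\<forall>X :: 'n \<Rightarrow> ('h \<Rightarrow>\<^sub>L 'h). (\<forall>i. X i \<in> bounded_ops) \<and> row_norm X \<ge> C \<longrightarrow>
          norm (free_eval tens A X) \<le> M * row_norm X ^ m)"
    then obtain M C where M: "0 < M" and growth: "\<And>X :: 'n \<Rightarrow> ('h \<Rightarrow>\<^sub>L 'h).
          (\<And>i. X i \<in> bounded_ops) \<Longrightarrow> C \<le> row_norm X \<Longrightarrow>
          norm (free_eval tens A X) \<le> M * row_norm X ^ m"
      by blast
    have "A \<alpha> = 0" if "m < length \<alpha>" for \<alpha>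
      using assms(1,2) A M growth that by (rule growth_imp_coeff_eq_0)
    then show "polynomial_degree_le A m"
      by (simp add: polynomial_degree_le_def)
  qed
qed

end
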